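(* Let $\mu$ be a Borel probability measure with compact support on a metric space and let $\Phi$ be a dimension function. Put $L=\limsup_{x\to0}\Phi(x)^{-1}$. Then $$\dim_F\mu\ge\underline{\dim}_\Phi\mu\ge\dim_F\mu-L\left(\overline{\dim}_M\mu-\dim_F\mu\right)$$ and $$\overline{\dim}_M\mu\le\overline{\dim}_\Phi\mu\le\overline{\dim}_M\mu+L\left(\overline{\dim}_M\mu-\dim_F\mu\right).$$
   Context: A dimension function is a map $\Phi:(0,1)\to[0,\infty)$ such that $x^{1+\Phi(x)}$ decreases to $0$ as $x$ decreases to $0$. $B(x,R)$ is the open ball of centre $x$ and radius $R$. $\overline{\dim}_\Phi\mu$ is the infimum of all $\alpha$ for which there exist $C_1,C_2>0$ such that for all $0<r<R^{1+\Phi(R)}\le R\le C_1$ and all $x\in\mathrm{supp}\,\mu$, $\mu(B(x,R))/\mu(B(x,r))\le C_2(R/r)^\alpha$; $\underline{\dim}_\Phi\mu$ is the supremum of all $\alpha$ for which there exist $C_1,C_2>0$ such that for the same $r,R,x$, $\mu(B(x,R))/\mu(B(x,r))\ge C_2(R/r)^\alpha$. For a compactly supported measure $\mu$ (with $\mathrm{diam}(\mathrm{supp}\,\mu)>0$), the upper Minkowski dimension is $$\overline{\dim}_M\mu=\inf\{t:\exists B>0 \text{ such that } \inf_{z\in\mathrm{supp}\,\mu}\mu(B(z,r))\ge Br^t\ \ \forall\, 0<r\le\mathrm{diam}(\mathrm{supp}\,\mu)\}$$ and the Frostman dimension is $$\dim_F\mu=\sup\{s:\exists A>0 \text{ such that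 } \sup_{z\in\mathrm{supp}\,\mu}\mu(B(z,r))\le Ar^s\ \ \forall\, 0<r\le\mathrm{diam}(\mathrm{supp}\,\mu)\}.$$ All dimensions take values in $[0,\infty]$, $1/0=\infty$, and the right-hand bounds involving $L$ are asserted whenever the expressions are meaningful, i.e. not of the indeterminate forms $0\cdot\infty$ or $\infty-\infty$. *)

theory Defs
  imports "HOL-Probability.Probability"
begin

definition dimension_function :: "(real \<Rightarrow> real) \<Rightarrow> bool" where
  "dimension_function \<Phi> \<longleftrightarrow>
     (\<forall>x\<in>{0<..<1}. 0 \<le> \<Phi> x) \<and>
     mono_on {0<..<1} (\<lambda>x. x powr (1 + \<Phi> x)) \<and>
     ((\<lambda>x. x powr (1 + \<Phi> x)) \<longlongrightarrow> 0) (at_right 0)"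

definition msupp :: "'a::metric_space measure \<Rightarrow> 'a set" where
  "msupp M = {x. \<forall>U. open U \<and> x \<in> U \<longrightarrow> 0 < measure M U}"

text \<open>
  The admissible scales are \<open>0 < r < R powr (1 + \<Phi> R) \<le> R \<le> C\<close>;
  the condition \<open>R < 1\<close> says that \<open>R\<close> lies in the domain of \<open>\<Phi>\<close>.
\<close>
definition admissible_scales :: "(real \<Rightarrow> real) \<Rightarrow> real \<Rightarrow> real \<Rightarrow> real \<Rightarrow> bool" where
  "admissible_scales \<Phi> C r R \<longleftrightarrow>
     0 < r \<and> r < R powr (1 + \<Phi> R) \<and> R powr (1 + \<Phi> R) \<le> R \<and> R \<le> C \<and> R < 1"

text \<open>
  In the four dimensions below the exponents are real numbers and the infimum or supremum is
  taken in the extended reals, so that the infimum of the empty set is \<open>\<infinity>\<close>.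
  For a dimension function and a probability measure whose support has positive finite
  diameter, no negative exponent satisfies the two conditions under an infimum, and the exponent \<open>0\<close> satisfies the two conditions under a supremum,
  so the values are in \<open>[0, \<infinity>]\<close>.
\<close>
definition upper_Phi_dim :: "(real \<Rightarrow> real) \<Rightarrow> 'a::metric_space measure \<Rightarrow> ereal" where
  "upper_Phi_dim \<Phi> M = Inf (ereal ` {\<alpha>. \<exists>C1>0. \<exists>C2>0. \<forall>r R. \<forall>x\<in>msupp M.
     admissible_scales \<Phi> C1 r R \<longrightarrow>
     measure M (ball x R) / measure M (ball x r) \<le> C2 * (R / r) powr \<alpha>})"

definition lower_Phi_dim :: "(real \<Rightarrow> real) \<Rightarrow> 'a::metric_space measure \<Rightarrow> ereal" where
  "lower_Phi_dim \<Phi> M = Sup (ereal ` {\<alpha>. \<exists>C1>0. \<exists>C2>0. \<forall>r R. \<forall>x\<in>msupp M.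
     admissible_scales \<Phi> C1 r R \<longrightarrow>
     measure M (ball x R) / measure M (ball x r) \<ge> C2 * (R / r) powr \<alpha>})"

definition upper_Minkowski_dim :: "'a::metric_space measure \<Rightarrow> ereal" where
  "upper_Minkowski_dim M = Inf (ereal ` {t. \<exists>B>0. \<forall>r. 0 < r \<and> r \<le> diameter (msupp M) \<longrightarrow>
     (INF z\<in>msupp M. measure M (ball z r)) \<ge> B * r powr t})"

definition Frostman_dim :: "'a::metric_space measure \<Rightarrow> ereal" where
  "Frostman_dim M = Sup (ereal ` {s. \<exists>A>0. \<forall>r. 0 < r \<and> r \<le> diameter (msupp M) \<longrightarrow>
     (SUP z\<in>msupp M. measure M (ball z r)) \<le> A * r powr s})"

text \<open>
  The following predicates exclude the indeterminate forms \<open>\<infinity> - \<infinity>\<close> and \<open>0 \<cdot> \<infinity>\<close>,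
  to which the total operations on \<^typ>\<open>ereal\<close> assign conventional values.
\<close>
definition add_meaningful :: "ereal \<Rightarrow> ereal \<Rightarrow> bool" where
  "add_meaningful a b \<longleftrightarrow> \<not> (a = \<infinity> \<and> b = -\<infinity>) \<and> \<not> (a = -\<infinity> \<and> b = \<infinity>)"

definition diff_meaningful :: "ereal \<Rightarrow> ereal \<Rightarrow> bool" where
  "diff_meaningful a b \<longleftrightarrow> add_meaningful a (- b)"

definition mult_meaningful :: "ereal \<Rightarrow> ereal \<Rightarrow> bool" where
  "mult_meaningful a b \<longleftrightarrow> \<not> (a = 0 \<and> \<bar>b\<bar> = \<infinity>) \<and> \<not> (\<bar>a\<bar> = \<infinity> \<and> b = 0)"

end

theory Submission
  imports Defs
begin

text \<open>
  Each dimension is an infimum or a supremum of exponents in a two-sided power law for the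
  measure of balls, and the proof compares the exponents directly.

  The two bounds without \<open>L\<close> come from freezing the large radius. With \<open>R\<close> fixed, the ratio
  \<open>\<mu>(B(x,R)) / \<mu>(B(x,r))\<close> is \<open>1 / \<mu>(B(x,r))\<close> up to constants, because \<open>\<mu>(B(x,R))\<close> is at most
  \<open>1\<close> and, by compactness of the support, is bounded away from \<open>0\<close> uniformly in \<open>x\<close>
  (\<open>ball_measure_bounded_below\<close>). An exponent for the ratio is therefore an exponent for the
  measures of small balls; in the Frostman case this is needed only for exponents \<open>\<ge> 0\<close>, since
  \<open>dim\<^sub>F\<close> is never negative.

  For the two bounds with \<open>L\<close>, take a Frostman exponent \<open>s\<close> and a Minkowski exponent \<open>t \<ge> s\<close>.
  The numerator and the denominator are estimated separately: up to constants,
  \<open>R^t r^{-s} \<le> \<mu>(B(x,R)) / \<mu>(B(x,r)) \<le> R^s r^{-t}\<close>. The outer terms are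
  \<open>(R/r)^s R^{t-s}\<close> and \<open>(R/r)^t R^{-(t-s)}\<close>, so only the factor \<open>R^{-(t-s)}\<close> has to be absorbed
  into a power of \<open>R/r\<close>. This is what the gap between the scales provides: if \<open>1/\<Phi> \<le> l\<close>
  near \<open>0\<close>, then \<open>r < R^{1+\<Phi>(R)} \<le> R^{1+1/l}\<close> says that \<open>1/R \<le> (R/r)^l\<close> (\<open>scale_gap\<close>).
  Hence \<open>s - l(t-s)\<close> and \<open>t + l(t-s)\<close> are exponents for the lower and upper \<open>\<Phi>\<close>-dimension,
  and letting \<open>s\<close>, \<open>t\<close>, \<open>l\<close> tend to \<open>dim\<^sub>F\<close>, \<open>dim\<^sub>M\<close>, \<open>L\<close> gives the claim when all three are
  finite. In every other case the expression is indeterminate or the bound is trivial.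
\<close>

section \<open>Exponents of a measure\<close>

definition Minkowski_exponent :: "'a::metric_space measure \<Rightarrow> real \<Rightarrow> bool" where
  "Minkowski_exponent M t \<longleftrightarrow> (\<exists>B>0. \<forall>r x. 0 < r \<and> r \<le> diameter (msupp M) \<and> x \<in> msupp M \<longrightarrow>
     B * r powr t \<le> measure M (ball x r))"

definition Frostman_exponent :: "'a::metric_space measure \<Rightarrow> real \<Rightarrow> bool" where
  "Frostman_exponent M s \<longleftrightarrow> (\<exists>A>0. \<forall>r x. 0 < r \<and> r \<le> diameter (msupp M) \<and> x \<in> msupp M \<longrightarrow>
     measure M (ball x r) \<le> A * r powr s)"

definition upper_Phi_exponent :: "(real \<Rightarrow> real) \<Rightarrow> 'a::metric_space measure \<Rightarrow> real \<Rightarrow> bool" where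
  "upper_Phi_exponent \<Phi> M \<alpha> \<longleftrightarrow> (\<exists>C1>0. \<exists>C2>0. \<forall>r R. \<forall>x\<in>msupp M.
     admissible_scales \<Phi> C1 r R \<longrightarrow>
     measure M (ball x R) / measure M (ball x r) \<le> C2 * (R / r) powr \<alpha>)"

definition lower_Phi_exponent :: "(real \<Rightarrow> real) \<Rightarrow> 'a::metric_space measure \<Rightarrow> real \<Rightarrow> bool" where
  "lower_Phi_exponent \<Phi> M \<alpha> \<longleftrightarrow> (\<exists>C1>0. \<exists>C2>0. \<forall>r R. \<forall>x\<in>msupp M.
     admissible_scales \<Phi> C1 r R \<longrightarrow>
     C2 * (R / r) powr \<alpha> \<le> measure M (ball x R) / measure M (ball x r))"

lemma upper_Phi_dim_eq: "upper_Phi_dim \<Phi> M = Inf (ereal ` Collect (upper_Phi_exponent \<Phi> M))"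
  unfolding upper_Phi_dim_def upper_Phi_exponent_def by simp

lemma lower_Phi_dim_eq: "lower_Phi_dim \<Phi> M = Sup (ereal ` Collect (lower_Phi_exponent \<Phi> M))"
  unfolding lower_Phi_dim_def lower_Phi_exponent_def by simp

section \<open>Separation of scales\<close>

text \<open>
  This is where \<open>\<Phi>\<close> enters: a lower bound \<open>1/l\<close> for \<open>\<Phi>(R)\<close> forces \<open>r/R < R^{1/l}\<close>, so a
  negative power of \<open>R\<close> alone costs no more than a power of \<open>R/r\<close>.
\<close>
lemma scale_gap:
  fixes r R l :: real
  assumes adm: "admissible_scales \<Phi> C r R" and l: "0 < l" "1 / l \<le> \<Phi> R"
  shows "1 / R \<le> (R / r) powr l"
proof -
  have r: "0 < r" and R: "r < R powr (1 + \<Phi> R)" "R powr (1 + \<Phi> R) \<le> R" "R < 1"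
    using adm by (auto simp: admissible_scales_def)
  have R0: "0 < R" using r R by linarith
  have "r / R < R powr \<Phi> R"
    using R(1) R0 by (simp add: powr_add field_simps)
  also have "\<dots> \<le> R powr (1 / l)"
    using l R0 R(3) by (intro powr_mono') auto
  finally have "(r / R) powr l \<le> (R powr (1 / l)) powr l"
    using r R0 l by (intro powr_mono2) auto
  then have "(r / R) powr l \<le> R"
    using l R0 by (simp add: powr_powr)
  then have "1 / R \<le> 1 / (r / R) powr l"
    using r R0 by (intro divide_left_mono) auto
  also have "\<dots> = (R / r) powr l"
    using r R0 by (simp add: powr_divide)
  finally show ?thesis .
qed

lemma scale_gap_powr:
  fixes r R l d :: real
  assumes "admissible_scales \<Phi> C r R" "0 < l" "1 / l \<le> \<Phi> R" "0 \<le> d"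
  shows "R powr (- d) \<le> (R / r) powr (l * d)"
proof -
  have R0: "0 < R"
    using assms(1) by (auto simp: admissible_scales_def intro: less_trans)
  have "(1 / R) powr d \<le> ((R / r) powr l) powr d"
    using scale_gap[OF assms(1-3)] assms(4) R0 by (intro powr_mono2) auto
  then show ?thesis
    using R0 by (simp add: powr_powr powr_minus_divide powr_divide)
qed

lemma admissible_scalesI:
  assumes "dimension_function \<Phi>" "0 < R" "R < 1" "R \<le> C" "0 < r" "r < R powr (1 + \<Phi> R)"
  shows "admissible_scales \<Phi> C r R"
proof -
  have "R powr (1 + \<Phi> R) \<le> R powr 1"
    using assms by (intro powr_mono') (auto simp: dimension_function_def)
  then show ?thesis
    using assms by (simp add: admissible_scales_def)
qed

section \<open>Balls centred in a compact support\<close>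

locale compactly_supported_prob = prob_space \<mu> for \<mu> :: "'a::metric_space measure" +
  assumes sets_borel: "sets \<mu> = sets borel"
    and compact_msupp: "compact (msupp \<mu>)"
    and diameter_pos: "0 < diameter (msupp \<mu>)"
begin

lemma msupp_nonempty: "msupp \<mu> \<noteq> {}"
  using diameter_pos by auto

lemma ball_pos: "x \<in> msupp \<mu> \<Longrightarrow> 0 < r \<Longrightarrow> 0 < measure \<mu> (ball x r)"
  unfolding msupp_def by auto

lemma ball_mono:
  assumes "ball x r \<subseteq> ball y R"
  shows "measure \<mu> (ball x r) \<le> measure \<mu> (ball y R)"
  using assms by (intro finite_measure_mono) (auto simp: sets_borel)

text \<open>
  Finitely many balls of radius \<open>R/2\<close> centred in the support cover it, and every ball of radius
  \<open>R\<close> centred in the support contains one of them.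
\<close>
lemma ball_measure_bounded_below:
  assumes "0 < R"
  obtains c where "0 < c" "\<And>x. x \<in> msupp \<mu> \<Longrightarrow> c \<le> measure \<mu> (ball x R)"
proof -
  obtain K where K: "finite K" "K \<subseteq> msupp \<mu>" "msupp \<mu> \<subseteq> (\<Union>y\<in>K. ball y (R/2))"
    using compactE_image[OF compact_msupp, of "msupp \<mu>" "\<lambda>y. ball y (R/2)"] assms
    by (metis (no_types, lifting) UN_iff centre_in_ball half_gt_zero open_ball subsetI)
  have K0: "K \<noteq> {}" using K(3) msupp_nonempty by auto
  define c where "c = Min ((\<lambda>y. measure \<mu> (ball y (R/2))) ` K)"
  have "0 < c"
    using K K0 assms by (auto simp: c_def intro!: ball_pos)
  moreover have "c \<le> measure \<mu> (ball x R)" if x: "x \<in> msupp \<mu>" for x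
  proof -
    obtain y where y: "y \<in> K" "dist y x < R/2" using K(3) x by auto
    have "ball y (R/2) \<subseteq> ball x R"
    proof
      fix z assume "z \<in> ball y (R/2)"
      then show "z \<in> ball x R"
        using y(2) dist_triangle[of x z y] by (simp add: dist_commute)
    qed
    then have "measure \<mu> (ball y (R/2)) \<le> measure \<mu> (ball x R)" by (rule ball_mono)
    moreover have "c \<le> measure \<mu> (ball y (R/2))" using K(1) y(1) by (simp add: c_def)
    ultimately show ?thesis by linarith
  qed
  ultimately show ?thesis using that by blast
qed

lemma upper_Minkowski_dim_eq: "upper_Minkowski_dim \<mu> = Inf (ereal ` Collect (Minkowski_exponent \<mu>))"
proof -
  have "b \<le> (INF z\<in>msupp \<mu>. measure \<mu> (ball z r)) \<longleftrightarrow> (\<forall>x\<in>msupp \<mu>. b \<le> measure \<mu> (ball x r))"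
    for b r :: real
    using msupp_nonempty by (intro le_cINF_iff) (auto intro!: bdd_belowI[of _ 0])
  then show ?thesis
    unfolding upper_Minkowski_dim_def Minkowski_exponent_def by (simp add: Ball_def imp_conjL)
qed

lemma Frostman_dim_eq: "Frostman_dim \<mu> = Sup (ereal ` Collect (Frostman_exponent \<mu>))"
proof -
  have "(SUP z\<in>msupp \<mu>. measure \<mu> (ball z r)) \<le> b \<longleftrightarrow> (\<forall>x\<in>msupp \<mu>. measure \<mu> (ball x r) \<le> b)"
    for b r :: real
    using msupp_nonempty by (intro cSUP_le_iff) (auto intro!: bdd_aboveI[of _ 1])
  then show ?thesis
    unfolding Frostman_dim_def Frostman_exponent_def by (simp add: Ball_def imp_conjL)
qed

text \<open>
  Only small radii matter: on radii between \<open>\<rho>\<close> and the diameter of the support, ball measures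
  and powers of the radius both lie between positive constants.
\<close>
lemma Minkowski_exponent_local:
  assumes "0 < \<rho>" "0 < B"
    and loc: "\<And>r x. 0 < r \<Longrightarrow> r < \<rho> \<Longrightarrow> x \<in> msupp \<mu> \<Longrightarrow> B * r powr t \<le> measure \<mu> (ball x r)"
  shows "Minkowski_exponent \<mu> t"
proof -
  obtain c where c: "0 < c" "\<And>x. x \<in> msupp \<mu> \<Longrightarrow> c \<le> measure \<mu> (ball x \<rho>)"
    using ball_measure_bounded_below[OF assms(1)] by blast
  define P where "P = \<rho> powr t + diameter (msupp \<mu>) powr t"
  have P: "0 < P" using assms(1) by (simp add: P_def add_pos_nonneg)
  have "min B (c / P) * r powr t \<le> measure \<mu> (ball x r)"
    if r: "0 < r" "r \<le> diameter (msupp \<mu>)" and x: "x \<in> msupp \<mu>" for r x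
  proof (cases "r < \<rho>")
    case True
    have "min B (c / P) * r powr t \<le> B * r powr t" by (intro mult_right_mono) auto
    then show ?thesis using loc[OF r(1) True x] by linarith
  next
    case False
    \<comment> \<open>A power is monotone in the base in one direction or the other, depending on the sign
      of the exponent, so \<open>P\<close> adds the values at both ends.\<close>
    have "r powr t \<le> P"
    proof (cases "0 \<le> t")
      case True
      then have "r powr t \<le> diameter (msupp \<mu>) powr t" using r by (intro powr_mono2) auto
      then show ?thesis by (simp add: P_def add_increasing)
    next
      case neg: False
      then have "r powr t \<le> \<rho> powr t" using False assms(1) by (intro powr_mono2') auto
      then show ?thesis by (simp add: P_def add_increasing2)
    qed
    then have "min B (c / P) * r powr t \<le> (c / P) * P"
      using P c(1) by (intro mult_mono) auto
    also have "\<dots> = c" using P by simp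
    also have "c \<le> measure \<mu> (ball x \<rho>)" using c(2) x .
    also have "\<dots> \<le> measure \<mu> (ball x r)" using False by (intro ball_mono) auto
    finally show ?thesis .
  qed
  moreover have "0 < min B (c / P)" using assms(2) c(1) P by simp
  ultimately show ?thesis unfolding Minkowski_exponent_def by blast
qed

lemma Frostman_exponent_local:
  assumes "0 < \<rho>" "0 < A" "0 \<le> s"
    and loc: "\<And>r x. 0 < r \<Longrightarrow> r < \<rho> \<Longrightarrow> x \<in> msupp \<mu> \<Longrightarrow> measure \<mu> (ball x r) \<le> A * r powr s"
  shows "Frostman_exponent \<mu> s"
proof -
  define A' where "A' = max A (1 / \<rho> powr s)"
  have "measure \<mu> (ball x r) \<le> A' * r powr s"
    if r: "0 < r" "r \<le> diameter (msupp \<mu>)" and x: "x \<in> msupp \<mu>" for r x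
  proof (cases "r < \<rho>")
    case True
    have "A * r powr s \<le> A' * r powr s" by (intro mult_right_mono) (auto simp: A'_def)
    then show ?thesis using loc[OF r(1) True x] by linarith
  next
    case False
    have "measure \<mu> (ball x r) \<le> (1 / \<rho> powr s) * \<rho> powr s" using assms(1) by simp
    also have "\<dots> \<le> A' * r powr s"
      using False assms by (intro mult_mono powr_mono2) (auto simp: A'_def)
    finally show ?thesis .
  qed
  moreover have "0 < A'" using assms(2) by (simp add: A'_def)
  ultimately show ?thesis unfolding Frostman_exponent_def by blast
qed

lemma Frostman_exponent_0: "Frostman_exponent \<mu> 0"
  by (rule Frostman_exponent_local[of 1 1]) auto

lemma Frostman_dim_nonneg: "0 \<le> Frostman_dim \<mu>"
  unfolding Frostman_dim_eq using Frostman_exponent_0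
  by (intro Sup_upper) (auto simp: zero_ereal_def)

text \<open>If \<open>t < s\<close>, then \<open>B * r^t \<le> A * r^s\<close> fails as \<open>r\<close> tends to \<open>0\<close>.\<close>
lemma Frostman_exponent_le_Minkowski_exponent:
  assumes "Frostman_exponent \<mu> s" "Minkowski_exponent \<mu> t"
  shows "s \<le> t"
proof (rule ccontr)
  assume "\<not> s \<le> t"
  then have d: "0 < s - t" by simp
  obtain A where A: "A > 0" "\<And>r x. 0 < r \<Longrightarrow> r \<le> diameter (msupp \<mu>) \<Longrightarrow> x \<in> msupp \<mu> \<Longrightarrow>
      measure \<mu> (ball x r) \<le> A * r powr s"
    using assms(1) unfolding Frostman_exponent_def by blast
  obtain B where B: "B > 0" "\<And>r x. 0 < r \<Longrightarrow> r \<le> diameter (msupp \<mu>) \<Longrightarrow> x \<in> msupp \<mu> \<Longrightarrow>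
      B * r powr t \<le> measure \<mu> (ball x r)"
    using assms(2) unfolding Minkowski_exponent_def by blast
  obtain x where x: "x \<in> msupp \<mu>" using msupp_nonempty by auto
  \<comment> \<open>The radius at which \<open>r^{s-t}\<close> equals \<open>B / (2A)\<close>, or the diameter if that is smaller.\<close>
  define r where "r = min (diameter (msupp \<mu>)) ((B / (2 * A)) powr (1 / (s - t)))"
  have r: "0 < r" "r \<le> diameter (msupp \<mu>)"
    using diameter_pos A(1) B(1) by (auto simp: r_def)
  have "r powr (s - t) \<le> ((B / (2 * A)) powr (1 / (s - t))) powr (s - t)"
    using r d by (intro powr_mono2) (auto simp: r_def)
  also have "\<dots> = B / (2 * A)" using d A(1) B(1) by (simp add: powr_powr)
  finally have small: "A * r powr (s - t) \<le> B / 2" using A(1) by (simp add: field_simps)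
  have "B * r powr t \<le> A * r powr s" using A(2)[OF r x] B(2)[OF r x] by linarith
  also have "\<dots> = (A * r powr (s - t)) * r powr t" by (simp flip: powr_add)
  also have "\<dots> \<le> (B / 2) * r powr t" using small by (intro mult_right_mono) auto
  finally show False using B(1) r(1) by simp
qed

lemma Frostman_dim_le_upper_Minkowski_dim: "Frostman_dim \<mu> \<le> upper_Minkowski_dim \<mu>"
  unfolding Frostman_dim_eq upper_Minkowski_dim_eq
  by (intro Sup_least Inf_greatest)
    (auto intro: Frostman_exponent_le_Minkowski_exponent)

section \<open>Bounds from a fixed large scale\<close>

lemma Frostman_exponent_if_lower_Phi_exponent:
  assumes \<Phi>: "dimension_function \<Phi>" and "lower_Phi_exponent \<Phi> \<mu> \<alpha>" "0 \<le> \<alpha>"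
  shows "Frostman_exponent \<mu> \<alpha>"
proof -
  obtain C1 C2 where C: "C1 > 0" "C2 > 0" "\<And>r R x. x \<in> msupp \<mu> \<Longrightarrow> admissible_scales \<Phi> C1 r R \<Longrightarrow>
      C2 * (R / r) powr \<alpha> \<le> measure \<mu> (ball x R) / measure \<mu> (ball x r)"
    using assms(2) unfolding lower_Phi_exponent_def by blast
  define R where "R = min C1 (1/2)"
  have R: "0 < R" "R < 1" "R \<le> C1" using C(1) by (auto simp: R_def)
  define \<rho> where "\<rho> = R powr (1 + \<Phi> R)"
  show ?thesis
  proof (rule Frostman_exponent_local[where \<rho> = \<rho> and A = "1 / (C2 * R powr \<alpha>)"])
    fix r x assume r: "0 < r" "r < \<rho>" and x: "x \<in> msupp \<mu>"
    have "C2 * (R / r) powr \<alpha> \<le> measure \<mu> (ball x R) / measure \<mu> (ball x r)"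
      using r R \<Phi> x by (intro C(3) admissible_scalesI) (auto simp: \<rho>_def)
    also have "\<dots> \<le> 1 / measure \<mu> (ball x r)" by (intro divide_right_mono) auto
    finally show "measure \<mu> (ball x r) \<le> 1 / (C2 * R powr \<alpha>) * r powr \<alpha>"
      using ball_pos[OF x r(1)] r(1) R(1) C(2) by (simp add: powr_divide field_simps)
  qed (use R C assms(3) in \<open>auto simp: \<rho>_def\<close>)
qed

lemma Minkowski_exponent_if_upper_Phi_exponent:
  assumes \<Phi>: "dimension_function \<Phi>" and "upper_Phi_exponent \<Phi> \<mu> \<alpha>"
  shows "Minkowski_exponent \<mu> \<alpha>"
proof -
  obtain C1 C2 where C: "C1 > 0" "C2 > 0" "\<And>r R x. x \<in> msupp \<mu> \<Longrightarrow> admissible_scales \<Phi> C1 r R \<Longrightarrow>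
      measure \<mu> (ball x R) / measure \<mu> (ball x r) \<le> C2 * (R / r) powr \<alpha>"
    using assms(2) unfolding upper_Phi_exponent_def by blast
  define R where "R = min C1 (1/2)"
  have R: "0 < R" "R < 1" "R \<le> C1" using C(1) by (auto simp: R_def)
  obtain c where c: "0 < c" "\<And>x. x \<in> msupp \<mu> \<Longrightarrow> c \<le> measure \<mu> (ball x R)"
    using ball_measure_bounded_below[OF R(1)] by blast
  define \<rho> where "\<rho> = R powr (1 + \<Phi> R)"
  show ?thesis
  proof (rule Minkowski_exponent_local[where \<rho> = \<rho> and B = "c / (C2 * R powr \<alpha>)"])
    fix r x assume r: "0 < r" "r < \<rho>" and x: "x \<in> msupp \<mu>"
    have "c / measure \<mu> (ball x r) \<le> measure \<mu> (ball x R) / measure \<mu> (ball x r)"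
      using c(2)[OF x] by (intro divide_right_mono) auto
    also have "\<dots> \<le> C2 * (R / r) powr \<alpha>"
      using r R \<Phi> x by (intro C(3) admissible_scalesI) (auto simp: \<rho>_def)
    finally show "c / (C2 * R powr \<alpha>) * r powr \<alpha> \<le> measure \<mu> (ball x r)"
      using ball_pos[OF x r(1)] r(1) R(1) C(2) by (simp add: powr_divide field_simps)
  qed (use R C c in \<open>auto simp: \<rho>_def\<close>)
qed

lemma lower_Phi_dim_le_Frostman_dim:
  assumes "dimension_function \<Phi>"
  shows "lower_Phi_dim \<Phi> \<mu> \<le> Frostman_dim \<mu>"
  unfolding lower_Phi_dim_eq
proof (rule Sup_least, clarsimp)
  fix \<alpha> assume \<alpha>: "lower_Phi_exponent \<Phi> \<mu> \<alpha>"
  show "ereal \<alpha> \<le> Frostman_dim \<mu>"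
  proof (cases "0 \<le> \<alpha>")
    case True
    then show ?thesis
      using Frostman_exponent_if_lower_Phi_exponent[OF assms \<alpha>]
      unfolding Frostman_dim_eq by (intro Sup_upper) auto
  next
    case False
    then have "ereal \<alpha> \<le> 0" by simp
    then show ?thesis using Frostman_dim_nonneg by (rule order_trans)
  qed
qed

lemma upper_Minkowski_dim_le_upper_Phi_dim:
  assumes "dimension_function \<Phi>"
  shows "upper_Minkowski_dim \<mu> \<le> upper_Phi_dim \<Phi> \<mu>"
  unfolding upper_Phi_dim_eq upper_Minkowski_dim_eq
  using Minkowski_exponent_if_upper_Phi_exponent[OF assms] by (intro Inf_superset_mono) auto

section \<open>Bounds from the separation of scales\<close>

text \<open>
  The common estimate behind the two bounds with \<open>L\<close>: the ball measures at the two scales are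
  controlled independently of each other, and the loss \<open>R^{-(t-s)}\<close> is a power of \<open>R/r\<close>.
\<close>
lemma ratio_bounds:
  assumes s: "Frostman_exponent \<mu> s" and t: "Minkowski_exponent \<mu> t"
    and l: "0 < l" and ev: "\<forall>\<^sub>F R in at_right 0. 1 / l \<le> \<Phi> R"
  shows "lower_Phi_exponent \<Phi> \<mu> (s - l * (t - s))" "upper_Phi_exponent \<Phi> \<mu> (t + l * (t - s))"
proof -
  have st: "0 \<le> t - s"
    using Frostman_exponent_le_Minkowski_exponent[OF s t] by simp
  obtain A where A: "A > 0" "\<And>r x. 0 < r \<Longrightarrow> r \<le> diameter (msupp \<mu>) \<Longrightarrow> x \<in> msupp \<mu> \<Longrightarrow>
      measure \<mu> (ball x r) \<le> A * r powr s"
    using s unfolding Frostman_exponent_def by blast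
  obtain B where B: "B > 0" "\<And>r x. 0 < r \<Longrightarrow> r \<le> diameter (msupp \<mu>) \<Longrightarrow> x \<in> msupp \<mu> \<Longrightarrow>
      B * r powr t \<le> measure \<mu> (ball x r)"
    using t unfolding Minkowski_exponent_def by blast
  obtain b where b: "0 < b" "\<And>R. 0 < R \<Longrightarrow> R < b \<Longrightarrow> 1 / l \<le> \<Phi> R"
    using ev unfolding eventually_at_right_field by auto
  define C where "C = min (b / 2) (diameter (msupp \<mu>))"
  have C: "0 < C" using b(1) diameter_pos by (simp add: C_def)
  have bounds:
    "(B / A) * (R / r) powr (s - l * (t - s)) \<le> measure \<mu> (ball x R) / measure \<mu> (ball x r) \<and>
     measure \<mu> (ball x R) / measure \<mu> (ball x r) \<le> (A / B) * (R / r) powr (t + l * (t - s))"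
    if x: "x \<in> msupp \<mu>" and adm: "admissible_scales \<Phi> C r R" for x r R
  proof -
    have rR: "0 < r" "r < R" "R \<le> C" using adm by (auto simp: admissible_scales_def)
    then have R: "0 < R" "R < b" "R \<le> diameter (msupp \<mu>)" and r: "r \<le> diameter (msupp \<mu>)"
      using b(1) by (auto simp: C_def)
    note powr = powr_divide powr_diff powr_add powr_minus field_simps
    have gap: "R powr (- (t - s)) \<le> (R / r) powr (l * (t - s))"
      using scale_gap_powr[OF adm l b(2)[OF R(1,2)] st] .
    have "(R / r) powr (s - l * (t - s)) = (R / r) powr s / (R / r) powr (l * (t - s))"
      using rR R by (simp add: powr_diff)
    also have "\<dots> \<le> (R / r) powr s / R powr (- (t - s))"
      using gap rR R by (intro divide_left_mono) auto
    also have "\<dots> = R powr t / r powr s"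
      using rR R by (simp add: powr)
    finally have "(B / A) * (R / r) powr (s - l * (t - s)) \<le> (B / A) * (R powr t / r powr s)"
      using A(1) B(1) by (intro mult_left_mono) auto
    also have "\<dots> = (B * R powr t) / (A * r powr s)" by simp
    also have "\<dots> \<le> measure \<mu> (ball x R) / measure \<mu> (ball x r)"
      using A(2)[OF rR(1) r x] B(2)[OF R(1,3) x] ball_pos[OF x rR(1)] by (intro frac_le) auto
    finally have lower: "(B / A) * (R / r) powr (s - l * (t - s))
      \<le> measure \<mu> (ball x R) / measure \<mu> (ball x r)" .
    have "measure \<mu> (ball x R) / measure \<mu> (ball x r) \<le> (A * R powr s) / (B * r powr t)"
      using A(2)[OF R(1,3) x] B(2)[OF rR(1) r x] A(1) B(1) rR(1) by (intro frac_le) auto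
    also have "\<dots> = (A / B) * ((R / r) powr t * R powr (- (t - s)))"
      using rR R by (simp add: powr)
    also have "\<dots> \<le> (A / B) * ((R / r) powr t * (R / r) powr (l * (t - s)))"
      using gap A(1) B(1) by (intro mult_left_mono) auto
    finally show ?thesis using lower rR R by (simp add: powr_add)
  qed
  show "lower_Phi_exponent \<Phi> \<mu> (s - l * (t - s))"
    unfolding lower_Phi_exponent_def using bounds C A(1) B(1)
    by (intro exI[of _ C] conjI exI[of _ "B / A"]) auto
  show "upper_Phi_exponent \<Phi> \<mu> (t + l * (t - s))"
    unfolding upper_Phi_exponent_def using bounds C A(1) B(1)
    by (intro exI[of _ C] conjI exI[of _ "A / B"]) auto
qed

lemma Phi_dim_approx:
  assumes F: "Frostman_dim \<mu> = ereal f" and M: "upper_Minkowski_dim \<mu> = ereal m"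
    and l: "0 < l" "\<forall>\<^sub>F R in at_right 0. 1 / l \<le> \<Phi> R" and "0 < \<epsilon>"
  shows "ereal (f - \<epsilon> - l * (m - f + 2 * \<epsilon>)) \<le> lower_Phi_dim \<Phi> \<mu>"
    and "upper_Phi_dim \<Phi> \<mu> \<le> ereal (m + \<epsilon> + l * (m - f + 2 * \<epsilon>))"
proof -
  have "ereal (f - \<epsilon>) < Frostman_dim \<mu>" using F \<open>0 < \<epsilon>\<close> by simp
  then obtain s where s: "Frostman_exponent \<mu> s" "f - \<epsilon> < s"
    unfolding Frostman_dim_eq less_Sup_iff by auto
  have "upper_Minkowski_dim \<mu> < ereal (m + \<epsilon>)" using M \<open>0 < \<epsilon>\<close> by simp
  then obtain t where t: "Minkowski_exponent \<mu> t" "t < m + \<epsilon>"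
    unfolding upper_Minkowski_dim_eq Inf_less_iff by auto
  have loss: "l * (t - s) \<le> l * (m - f + 2 * \<epsilon>)"
    using s(2) t(2) l(1) by (intro mult_left_mono) auto
  note exps = ratio_bounds[OF s(1) t(1) l]
  have "ereal (s - l * (t - s)) \<le> lower_Phi_dim \<Phi> \<mu>"
    unfolding lower_Phi_dim_eq using exps(1) by (intro Sup_upper) auto
  moreover have "ereal (f - \<epsilon> - l * (m - f + 2 * \<epsilon>)) \<le> ereal (s - l * (t - s))"
    using loss s(2) by simp
  ultimately show "ereal (f - \<epsilon> - l * (m - f + 2 * \<epsilon>)) \<le> lower_Phi_dim \<Phi> \<mu>"
    using order_trans by blast
  have "upper_Phi_dim \<Phi> \<mu> \<le> ereal (t + l * (t - s))"
    unfolding upper_Phi_dim_eq using exps(2) by (intro Inf_lower) auto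
  moreover have "ereal (t + l * (t - s)) \<le> ereal (m + \<epsilon> + l * (m - f + 2 * \<epsilon>))"
    using loss t(2) by simp
  ultimately show "upper_Phi_dim \<Phi> \<mu> \<le> ereal (m + \<epsilon> + l * (m - f + 2 * \<epsilon>))"
    using order_trans by blast
qed

lemma Phi_dim_bounds_finite:
  assumes F: "Frostman_dim \<mu> = ereal f" and M: "upper_Minkowski_dim \<mu> = ereal m"
    and \<Phi>: "dimension_function \<Phi>"
    and L: "Limsup (at_right 0) (\<lambda>x. 1 / ereal (\<Phi> x)) = ereal l" and l: "0 \<le> l"
  shows "ereal (f - l * (m - f)) \<le> lower_Phi_dim \<Phi> \<mu>"
    and "upper_Phi_dim \<Phi> \<mu> \<le> ereal (m + l * (m - f))"
proof -
  have ev: "\<forall>\<^sub>F R in at_right 0. 1 / (l + \<epsilon>) \<le> \<Phi> R" if "0 < \<epsilon>" for \<epsilon>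
  proof -
    have "Limsup (at_right 0) (\<lambda>x. 1 / ereal (\<Phi> x)) < ereal (l + \<epsilon>)" using L that by simp
    then have "\<forall>\<^sub>F x in at_right 0. 1 / ereal (\<Phi> x) < ereal (l + \<epsilon>)" by (rule Limsup_lessD)
    moreover have "\<forall>\<^sub>F x::real in at_right 0. x \<in> {0<..<1}"
      by (rule eventually_at_right_real) simp
    ultimately show ?thesis
    proof eventually_elim
      case (elim x)
      have "0 \<le> \<Phi> x" using \<Phi> elim(2) by (simp add: dimension_function_def)
      moreover have "\<Phi> x \<noteq> 0" using elim(1) by (auto simp: divide_ereal_def)
      ultimately have pos: "0 < \<Phi> x" by simp
      then have "1 / \<Phi> x < l + \<epsilon>" using elim(1) by (simp add: one_ereal_def)
      then show ?case using pos l that by (simp add: field_simps)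
    qed
  qed
  note approx = Phi_dim_approx[OF F M _ ev]
  have "((\<lambda>\<epsilon>. f - \<epsilon> - (l + \<epsilon>) * (m - f + 2 * \<epsilon>)) \<longlongrightarrow> f - 0 - (l + 0) * (m - f + 2 * 0)) (at_right 0)"
    by (intro tendsto_intros)
  then have lim: "((\<lambda>\<epsilon>. ereal (f - \<epsilon> - (l + \<epsilon>) * (m - f + 2 * \<epsilon>))) \<longlongrightarrow> ereal (f - l * (m - f))) (at_right 0)"
    by simp
  have pos: "\<forall>\<^sub>F \<epsilon>::real in at_right 0. 0 < \<epsilon>" by (rule eventually_at_right_less)
  show "ereal (f - l * (m - f)) \<le> lower_Phi_dim \<Phi> \<mu>"
    by (rule tendsto_upperbound[OF lim eventually_mono[OF pos]])
      (use l in \<open>auto intro!: approx(1)\<close>)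
  have "((\<lambda>\<epsilon>. m + \<epsilon> + (l + \<epsilon>) * (m - f + 2 * \<epsilon>)) \<longlongrightarrow> m + 0 + (l + 0) * (m - f + 2 * 0)) (at_right 0)"
    by (intro tendsto_intros)
  then have lim: "((\<lambda>\<epsilon>. ereal (m + \<epsilon> + (l + \<epsilon>) * (m - f + 2 * \<epsilon>))) \<longlongrightarrow> ereal (m + l * (m - f))) (at_right 0)"
    by simp
  show "upper_Phi_dim \<Phi> \<mu> \<le> ereal (m + l * (m - f))"
    by (rule tendsto_lowerbound[OF lim eventually_mono[OF pos]])
      (use l in \<open>auto intro!: approx(2)\<close>)
qed

text \<open>
  If \<open>dim\<^sub>M\<close> or \<open>L\<close> is infinite and no form is indeterminate, then the product is \<open>\<infinity>\<close>, so
  the bounds are \<open>-\<infinity>\<close> and \<open>\<infinity>\<close>.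
\<close>
lemma Phi_dim_bounds:
  assumes \<Phi>: "dimension_function \<Phi>"
    and L: "L = Limsup (at_right 0) (\<lambda>x. 1 / ereal (\<Phi> x))"
    and diff: "diff_meaningful (upper_Minkowski_dim \<mu>) (Frostman_dim \<mu>)"
    and mult: "mult_meaningful L (upper_Minkowski_dim \<mu> - Frostman_dim \<mu>)"
  shows "Frostman_dim \<mu> - L * (upper_Minkowski_dim \<mu> - Frostman_dim \<mu>) \<le> lower_Phi_dim \<Phi> \<mu>"
    and "upper_Phi_dim \<Phi> \<mu> \<le> upper_Minkowski_dim \<mu> + L * (upper_Minkowski_dim \<mu> - Frostman_dim \<mu>)"
proof -
  let ?F = "Frostman_dim \<mu>" and ?M = "upper_Minkowski_dim \<mu>"
  let ?goal = "?F - L * (?M - ?F) \<le> lower_Phi_dim \<Phi> \<mu> \<and> upper_Phi_dim \<Phi> \<mu> \<le> ?M + L * (?M - ?F)"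
  have FM: "?F \<le> ?M" by (rule Frostman_dim_le_upper_Minkowski_dim)
  have F0: "0 \<le> ?F" by (rule Frostman_dim_nonneg)
  \<comment> \<open>Otherwise \<open>dim\<^sub>M\<close> is infinite too, and the difference is \<open>\<infinity> - \<infinity>\<close>.\<close>
  have "?F \<noteq> \<infinity>"
    using diff FM by (auto simp: diff_meaningful_def add_meaningful_def)
  then obtain f where f: "?F = ereal f" "0 \<le> f"
    using F0 by (cases ?F) auto
  have D0: "0 \<le> ?M - ?F" using FM f by (cases ?M) auto
  have L0: "0 \<le> L"
  proof -
    have "\<forall>\<^sub>F x::real in at_right 0. x \<in> {0<..<1}"
      by (rule eventually_at_right_real) simp
    then have "\<forall>\<^sub>F x in at_right 0. (0::ereal) \<le> 1 / ereal (\<Phi> x)"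
      by eventually_elim (use \<Phi> in \<open>auto simp: dimension_function_def divide_ereal_def\<close>)
    then show ?thesis unfolding L by (intro le_Limsup) auto
  qed
  have goal: ?goal
  proof (cases "L * (?M - ?F) = \<infinity>")
    case True
    then show ?thesis using f F0 FM by auto
  next
    case False
    have "L \<noteq> \<infinity>" "?M - ?F \<noteq> \<infinity>"
      using False mult L0 D0 by (auto simp: mult_meaningful_def ereal_mult_eq_PInfty)
    then obtain l m where "L = ereal l" "0 \<le> l" "?M = ereal m"
      using L0 f FM by (cases L; cases ?M) auto
    then show ?thesis
      using Phi_dim_bounds_finite[OF f(1) _ \<Phi>] L f(1) by simp
  qed
  show "?F - L * (?M - ?F) \<le> lower_Phi_dim \<Phi> \<mu>" using goal by blast
  show "upper_Phi_dim \<Phi> \<mu> \<le> ?M + L * (?M - ?F)" using goal by blast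
qed

end

section \<open>Comparison of the dimensions\<close>

theorem theorem2p21:
  fixes \<mu> :: "'a::metric_space measure"
    and \<Phi> :: "real \<Rightarrow> real"
    and L :: ereal
  assumes "prob_space \<mu>"
    and "sets \<mu> = sets borel"
    and "compact (msupp \<mu>)"
    and "diameter (msupp \<mu>) > 0"
    and "dimension_function \<Phi>"
    and "L = Limsup (at_right 0) (\<lambda>x. 1 / ereal (\<Phi> x))"
  shows "Frostman_dim \<mu> \<ge> lower_Phi_dim \<Phi> \<mu> \<and>
    (diff_meaningful (upper_Minkowski_dim \<mu>) (Frostman_dim \<mu>) \<and>
     mult_meaningful L (upper_Minkowski_dim \<mu> - Frostman_dim \<mu>) \<and>
     diff_meaningful (Frostman_dim \<mu>) (L * (upper_Minkowski_dim \<mu> - Frostman_dim \<mu>)) \<longrightarrow>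
       lower_Phi_dim \<Phi> \<mu> \<ge> Frostman_dim \<mu> - L * (upper_Minkowski_dim \<mu> - Frostman_dim \<mu>)) \<and>
    upper_Minkowski_dim \<mu> \<le> upper_Phi_dim \<Phi> \<mu> \<and>
    (diff_meaningful (upper_Minkowski_dim \<mu>) (Frostman_dim \<mu>) \<and>
     mult_meaningful L (upper_Minkowski_dim \<mu> - Frostman_dim \<mu>) \<and>
     add_meaningful (upper_Minkowski_dim \<mu>) (L * (upper_Minkowski_dim \<mu> - Frostman_dim \<mu>)) \<longrightarrow>
       upper_Phi_dim \<Phi> \<mu> \<le> upper_Minkowski_dim \<mu> + L * (upper_Minkowski_dim \<mu> - Frostman_dim \<mu>))"
proof -
  interpret prob_space \<mu> by fact
  interpret compactly_supported_prob \<mu>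
    by unfold_locales (use assms in auto)
  show ?thesis
    using lower_Phi_dim_le_Frostman_dim upper_Minkowski_dim_le_upper_Phi_dim
      Phi_dim_bounds assms(5,6) by blast
qed

end
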